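(* There is a constant $C$ such that for every positive integer $k$ there is a finite oriented graph $G$ such that the underlying graph of $G$ is 2-connected, every indegree and every outdegree in $G$ is at most $k+C$, and $\overrightarrow{\lambda}_{2,1}(G)\geq k^2-Ck$.
   Context: An oriented graph is a directed graph whose underlying undirected graph is simple (no loops, no multiple edges, and no pair of opposite arcs). An $L(2,1)$-labeling of an oriented graph $G$ is a function $f:V(G)\to\{0,\dots,m\}$, for some integer $m \ge 0$, such that $|f(u)-f(v)|\geq 2$ whenever $u$ and $v$ are adjacent (joined by an arc in either direction), and $|f(u)-f(v)|\geq 1$ whenever $u\neq v$ are joined by a directed path of length two (that is, there is a vertex $w$ with $u\to w\to v$ or $v\to w\to u$). The number $\overrightarrow{\lambda}_{2,1}(G)$ is the minimum $m$ for which such a labeling exists. *)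

theory Defs
  imports Complex_Main "Graph_Theory.Digraph_Component"
begin

text \<open>The locale \<^locale>\<open>digraph\<close> already gives finiteness, no loops and no parallel arcs.\<close>
locale oriented_graph = digraph +
  assumes no_opposite_arcs: "u \<rightarrow>\<^bsub>G\<^esub> v \<Longrightarrow> \<not> v \<rightarrow>\<^bsub>G\<^esub> u"

text \<open>
  The usual \<open>k\<close>-connectedness of a finite graph: more than \<open>k\<close> vertices, and connected after the
  removal of any fewer than \<open>k\<close> of them. In particular, the single edge is not 2-connected.
\<close>
definition k_connected :: "nat \<Rightarrow> ('a, 'b) pre_digraph \<Rightarrow> bool" where
  "k_connected k G \<longleftrightarrow>
     k < card (verts G) \<and>
     (\<forall>S \<subseteq> verts G. finite S \<and> card S < k \<longrightarrow>
        Digraph_Component.connected (G \<restriction> (verts G - S)))"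

definition L21_labeling :: "('a, 'b) pre_digraph \<Rightarrow> nat \<Rightarrow> ('a \<Rightarrow> nat) \<Rightarrow> bool" where
  "L21_labeling G m f \<longleftrightarrow>
     f ` verts G \<subseteq> {0..m} \<and>
     (\<forall>u \<in> verts G. \<forall>v \<in> verts G.
        u \<rightarrow>\<^bsub>G\<^esub> v \<or> v \<rightarrow>\<^bsub>G\<^esub> u \<longrightarrow> \<bar>int (f u) - int (f v)\<bar> \<ge> 2) \<and>
     (\<forall>u \<in> verts G. \<forall>v \<in> verts G.
        u \<noteq> v \<and> (\<exists>w \<in> verts G. (u \<rightarrow>\<^bsub>G\<^esub> w \<and> w \<rightarrow>\<^bsub>G\<^esub> v) \<or> (v \<rightarrow>\<^bsub>G\<^esub> w \<and> w \<rightarrow>\<^bsub>G\<^esub> u))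
        \<longrightarrow> \<bar>int (f u) - int (f v)\<bar> \<ge> 1)"

definition lambda21 :: "('a, 'b) pre_digraph \<Rightarrow> nat" where
  "lambda21 G = (LEAST m. \<exists>f. L21_labeling G m f)"

text \<open>The minimum is attained, so \<^const>\<open>lambda21\<close> is meaningful on every oriented graph.\<close>

lemma (in oriented_graph) L21_labeling_exists: "\<exists>m f. L21_labeling G m f"
proof -
  obtain g :: "'a \<Rightarrow> nat" where g: "inj_on g (verts G)"
    using finite_imp_inj_to_nat_seg[OF finite_verts] by blast
  define f where "f = (\<lambda>v. 2 * g v)"
  have far: "\<bar>int (f u) - int (f v)\<bar> \<ge> 2"
    if "u \<in> verts G" "v \<in> verts G" "u \<noteq> v" for u v
  proof -
    have "g u \<noteq> g v" using g that by (auto dest: inj_onD)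
    then show ?thesis unfolding f_def by linarith
  qed
  have range: "f ` verts G \<subseteq> {0..Max (f ` verts G)}"
    using finite_verts by auto
  have "L21_labeling G (Max (f ` verts G)) f"
    unfolding L21_labeling_def
  proof (intro conjI range ballI impI)
    fix u v assume uv: "u \<in> verts G" "v \<in> verts G" "u \<rightarrow>\<^bsub>G\<^esub> v \<or> v \<rightarrow>\<^bsub>G\<^esub> u"
    then have "u \<noteq> v" using adj_not_same by blast
    with uv show "\<bar>int (f u) - int (f v)\<bar> \<ge> 2" by (intro far)
  next
    fix u v assume uv: "u \<in> verts G" "v \<in> verts G"
      "u \<noteq> v \<and> (\<exists>w \<in> verts G. (u \<rightarrow>\<^bsub>G\<^esub> w \<and> w \<rightarrow>\<^bsub>G\<^esub> v) \<or> (v \<rightarrow>\<^bsub>G\<^esub> w \<and> w \<rightarrow>\<^bsub>G\<^esub> u))"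
    then have "\<bar>int (f u) - int (f v)\<bar> \<ge> 2" by (intro far) auto
    then show "\<bar>int (f u) - int (f v)\<bar> \<ge> 1" by linarith
  qed
  then show ?thesis by blast
qed

lemma (in oriented_graph) L21_labeling_lambda21: "\<exists>f. L21_labeling G (lambda21 G) f"
  unfolding lambda21_def using L21_labeling_exists by (rule LeastI_ex)

end

theory Submission
  imports Defs "HOL-Library.Nat_Bijection"
begin

text \<open>
  Take the \<open>q \<times> q\<close> grid of points. Order the rows by a regular tournament (for even \<open>q\<close>, antipodal
  rows are joined both ways), and for every tournament arc from row \<open>i\<close> to row \<open>j\<close> add a hub that
  receives arcs from all points of row \<open>i\<close> and sends arcs to all points of row \<open>j\<close>. Do the same for
  the columns. Any two points differ in their row or in their column, so they are joined by a
  directed path of length two through a hub and all \<open>q\<^sup>2\<close> labels of points are distinct. A point has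
  at most \<open>q div 2\<close> out-hubs from its row and as many from its column, and a hub has degree \<open>q\<close>
  in both directions. With \<open>q = k + 2\<close> the grid is large enough to be 2-connected for all \<open>k\<close>.
\<close>

section \<open>A circulant order on the lines\<close>

text \<open>The circulant digraph on the residues modulo \<open>q\<close> with steps
  \<open>1\<close> to \<open>q div 2\<close>. Since \<open>i + d < 2 * q\<close>, the two equations
  together say that \<open>i + d\<close> is congruent to \<open>j\<close>.\<close>

definition circ_arc :: "nat \<Rightarrow> nat \<Rightarrow> nat \<Rightarrow> bool" where
  "circ_arc q i j \<longleftrightarrow> i < q \<and> j < q \<and> (\<exists>d \<in> {1..q div 2}. i + d = j \<or> i + d = j + q)"

lemma circ_arc_lt: "circ_arc q i j \<Longrightarrow> i < q \<and> j < q"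
  unfolding circ_arc_def by blast

lemma circ_arc_irrefl [simp]: "\<not> circ_arc q i i"
  unfolding circ_arc_def by auto

text \<open>The cyclic distances from \<open>i\<close> to \<open>j\<close> and from \<open>j\<close>
  to \<open>i\<close> add up to \<open>q\<close>, so the smaller one is at most
  \<open>q div 2\<close>.\<close>

lemma circ_arc_total:
  assumes "i < q" "j < q" "i \<noteq> j"
  shows "circ_arc q i j \<or> circ_arc q j i"
proof -
  have *: "circ_arc q i j \<or> circ_arc q j i" if "i < j" "j < q" for i j
  proof (cases "j - i \<le> q div 2")
    case True
    then have "j - i \<in> {1..q div 2}" "i + (j - i) = j" using that by simp_all
    then show ?thesis unfolding circ_arc_def using that by fastforce
  next
    case False
    then have "i + q - j \<le> q div 2" "1 \<le> i + q - j" "j + (i + q - j) = i + q"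
      using that by linarith+
    then have "circ_arc q j i" unfolding circ_arc_def using that by (meson atLeastAtMost_iff less_trans)
    then show ?thesis ..
  qed
  show ?thesis using *[of i j] *[of j i] assms by linarith
qed

text \<open>For fixed \<open>i\<close> the step \<open>d\<close> determines \<open>j\<close>, and
  there are \<open>q div 2\<close> steps; the conditional in the image is reduction modulo
  \<open>q\<close>.\<close>

lemma circ_arc_out: "finite {j. circ_arc q i j}" "card {j. circ_arc q i j} \<le> q div 2"
proof -
  have "j \<in> (\<lambda>d. if i + d < q then i + d else i + d - q) ` {1..q div 2}" if "circ_arc q i j" for j
  proof -
    from that obtain d where "d \<in> {1..q div 2}" "j < q" "i + d = j \<or> i + d = j + q"
      unfolding circ_arc_def by blast
    then show ?thesis by (intro image_eqI[of _ _ d]) auto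
  qed
  then have "{j. circ_arc q i j} \<subseteq> (\<lambda>d. if i + d < q then i + d else i + d - q) ` {1..q div 2}"
    by blast
  from finite_subset[OF this] surj_card_le[OF _ this]
  show "finite {j. circ_arc q i j}" "card {j. circ_arc q i j} \<le> q div 2" by auto
qed

lemma circ_arc_in: "finite {i. circ_arc q i j}" "card {i. circ_arc q i j} \<le> q div 2"
proof -
  have "i \<in> (\<lambda>d. if d \<le> j then j - d else j + q - d) ` {1..q div 2}" if "circ_arc q i j" for i
  proof -
    from that obtain d where "d \<in> {1..q div 2}" "i < q" "i + d = j \<or> i + d = j + q"
      unfolding circ_arc_def by blast
    then show ?thesis by (intro image_eqI[of _ _ d]) auto
  qed
  then have "{i. circ_arc q i j} \<subseteq> (\<lambda>d. if d \<le> j then j - d else j + q - d) ` {1..q div 2}"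
    by blast
  from finite_subset[OF this] surj_card_le[OF _ this]
  show "finite {i. circ_arc q i j}" "card {i. circ_arc q i j} \<le> q div 2" by auto
qed

section \<open>The grid graph: points, hubs and arcs\<close>

text \<open>
  The direction \<open>t\<close> selects rows (\<open>True\<close>) or columns (\<open>False\<close>): \<open>line_point t i c\<close> is the \<open>c\<close>-th
  point of the \<open>i\<close>-th line in direction \<open>t\<close>.
\<close>

definition point :: "nat \<Rightarrow> nat \<Rightarrow> nat" where
  "point a b = prod_encode (0, prod_encode (a, b))"

text \<open>The tags 1 and 2 separate row hubs from column hubs, and both from points, which carry
  tag 0. The pairing function turns all of them into natural numbers, the vertex type of the final
  graph.\<close>

definition hub :: "bool \<Rightarrow> nat \<Rightarrow> nat \<Rightarrow> nat" where
  "hub t i j = prod_encode (if t then 1 else 2, prod_encode (i, j))"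

definition line_point :: "bool \<Rightarrow> nat \<Rightarrow> nat \<Rightarrow> nat" where
  "line_point t i c = (if t then point i c else point c i)"

lemma point_eq [simp]: "point a b = point a' b' \<longleftrightarrow> a = a' \<and> b = b'"
  and hub_eq [simp]: "hub t i j = hub t' i' j' \<longleftrightarrow> t = t' \<and> i = i' \<and> j = j'"
  and point_neq_hub [simp]: "point a b \<noteq> hub t i j" "hub t i j \<noteq> point a b"
  unfolding point_def hub_def by auto

lemma line_point_eq [simp]: "line_point t i c = line_point t i' c' \<longleftrightarrow> i = i' \<and> c = c'"
  and line_point_neq_hub [simp]: "line_point t i c \<noteq> hub t' i' j" "hub t' i' j \<noteq> line_point t i c"
  unfolding line_point_def by auto

definition grid_verts :: "nat \<Rightarrow> nat set" where
  "grid_verts q = {point a b | a b. a < q \<and> b < q} \<union> {hub t i j | t i j. circ_arc q i j}"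

definition grid_arcs :: "nat \<Rightarrow> (nat \<times> nat) set" where
  "grid_arcs q =
     {(line_point t i c, hub t i j) | t i j c. circ_arc q i j \<and> c < q} \<union>
     {(hub t i j, line_point t j c) | t i j c. circ_arc q i j \<and> c < q}"

definition grid :: "nat \<Rightarrow> (nat, nat \<times> nat) pre_digraph" where
  "grid q = with_proj \<lparr>pverts = grid_verts q, parcs = grid_arcs q\<rparr>"

lemma grid_simps [simp]:
  "verts (grid q) = grid_verts q" "arcs (grid q) = grid_arcs q"
  "tail (grid q) = fst" "head (grid q) = snd" "arcs_ends (grid q) = grid_arcs q"
  unfolding grid_def by auto

lemma point_in_grid_verts: "point a b \<in> grid_verts q \<longleftrightarrow> a < q \<and> b < q"
  unfolding grid_verts_def by auto

lemma line_point_in_grid_verts: "line_point t i c \<in> grid_verts q \<longleftrightarrow> i < q \<and> c < q"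
  unfolding line_point_def by (auto simp: point_in_grid_verts)

lemma hub_in_grid_verts: "hub t i j \<in> grid_verts q \<longleftrightarrow> circ_arc q i j"
  unfolding grid_verts_def by auto

lemma grid_verts_cases:
  assumes "v \<in> grid_verts q"
  obtains (point) a b where "v = point a b" "a < q" "b < q"
    | (hub) t i j where "v = hub t i j" "circ_arc q i j"
  using assms unfolding grid_verts_def by blast

text \<open>Swapping coordinates turns a row description of a point into a column description. The
  connectivity proof uses this to pass to the direction whose hubs survive.\<close>

lemma line_point_change_direction:
  obtains i' c' where "line_point s i c = line_point t i' c'"
  by (cases "s = t") (auto simp: line_point_def)

lemma grid_arcs_subset: "grid_arcs q \<subseteq> grid_verts q \<times> grid_verts q"
  unfolding grid_arcs_def
  by (auto simp: line_point_in_grid_verts hub_in_grid_verts dest: circ_arc_lt)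

lemma finite_grid_verts: "finite (grid_verts q)"
proof -
  have "grid_verts q \<subseteq> (\<Union>a<q. \<Union>b<q. {point a b}) \<union> (\<Union>t. \<Union>i<q. \<Union>j<q. {hub t i j})"
    unfolding grid_verts_def by (auto dest: circ_arc_lt)
  then show ?thesis by (rule finite_subset) simp
qed

text \<open>Arcs only run between points and hubs, and \<open>hub t i j\<close> has its
  in-neighbours on line \<open>i\<close> and its out-neighbours on the different line
  \<open>j\<close>. Lines joined both ways do no harm, because each of the two arcs has its own
  hub.\<close>

lemma grid_arcs_asym: "(u, v) \<in> grid_arcs q \<Longrightarrow> (v, u) \<notin> grid_arcs q"
  unfolding grid_arcs_def by auto

lemma oriented_graph_grid: "oriented_graph (grid q)"
proof
  show "finite (arcs (grid q))"
    using finite_subset[OF grid_arcs_subset] finite_grid_verts by simp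
  show "tail (grid q) e \<noteq> head (grid q) e" if "e \<in> arcs (grid q)" for e
    using that grid_arcs_asym[of "fst e" "fst e" q] by (cases e) auto
  show "tail (grid q) e \<in> verts (grid q)" "head (grid q) e \<in> verts (grid q)"
    if "e \<in> arcs (grid q)" for e
    using that grid_arcs_subset[of q] by (auto dest!: subsetD)
qed (simp_all add: finite_grid_verts grid_arcs_asym arc_to_ends_def prod_eq_iff)

section \<open>Degree bounds\<close>

lemma arc_from_point:
  assumes "(point a b, w) \<in> grid_arcs q"
  shows "(\<exists>j. w = hub True a j \<and> circ_arc q a j) \<or> (\<exists>j. w = hub False b j \<and> circ_arc q b j)"
proof -
  obtain t i j c where "point a b = line_point t i c" "w = hub t i j" "circ_arc q i j"
    using assms unfolding grid_arcs_def by auto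
  then show ?thesis by (cases t) (auto simp: line_point_def)
qed

lemma arc_to_point:
  assumes "(w, point a b) \<in> grid_arcs q"
  shows "(\<exists>i. w = hub True i a \<and> circ_arc q i a) \<or> (\<exists>i. w = hub False i b \<and> circ_arc q i b)"
proof -
  obtain t i j c where "point a b = line_point t j c" "w = hub t i j" "circ_arc q i j"
    using assms unfolding grid_arcs_def by auto
  then show ?thesis by (cases t) (auto simp: line_point_def)
qed

lemma card_line_arcs:
  "card ((\<lambda>c. f (line_point t i c)) ` {..<q}) \<le> q"
  using card_image_le[of "{..<q}"] by simp

text \<open>Counts the arcs at a point: row hubs and column hubs contribute at most
  \<open>q div 2\<close> each, and twice that is at most \<open>q\<close> for either parity.\<close>

lemma card_hub_arcs:
  assumes "finite J" "card J \<le> q div 2" "finite I" "card I \<le> q div 2"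
  shows "card (f ` J \<union> g ` I) \<le> q"
proof -
  have "card (f ` J \<union> g ` I) \<le> card (f ` J) + card (g ` I)" by (rule card_Un_le)
  also have "\<dots> \<le> card J + card I" using assms by (intro add_mono card_image_le)
  finally show ?thesis using assms by linarith
qed

lemma out_degree_grid:
  assumes "v \<in> grid_verts q"
  shows "out_degree (grid q) v \<le> q"
  using assms
proof (cases rule: grid_verts_cases)
  case (point a b)
  let ?A = "(\<lambda>j. (v, hub True a j)) ` {j. circ_arc q a j} \<union>
    (\<lambda>j. (v, hub False b j)) ` {j. circ_arc q b j}"
  have "out_arcs (grid q) v \<subseteq> ?A"
    using point by (auto simp: out_arcs_def dest!: arc_from_point)
  moreover have "finite ?A" by (simp add: circ_arc_out)
  moreover have "card ?A \<le> q" by (intro card_hub_arcs circ_arc_out)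
  ultimately show ?thesis unfolding out_degree_def by (meson card_mono le_trans)
next
  case (hub t i j)
  let ?A = "(\<lambda>c. (v, line_point t j c)) ` {..<q}"
  have "out_arcs (grid q) v \<subseteq> ?A"
    using hub by (auto simp: out_arcs_def grid_arcs_def)
  moreover have "card ?A \<le> q" by (rule card_line_arcs)
  ultimately show ?thesis unfolding out_degree_def by (meson card_mono finite_imageI finite_lessThan le_trans)
qed

lemma in_degree_grid:
  assumes "v \<in> grid_verts q"
  shows "in_degree (grid q) v \<le> q"
  using assms
proof (cases rule: grid_verts_cases)
  case (point a b)
  let ?A = "(\<lambda>i. (hub True i a, v)) ` {i. circ_arc q i a} \<union>
    (\<lambda>i. (hub False i b, v)) ` {i. circ_arc q i b}"
  have "in_arcs (grid q) v \<subseteq> ?A"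
    using point by (auto simp: in_arcs_def dest!: arc_to_point)
  moreover have "finite ?A" by (simp add: circ_arc_in)
  moreover have "card ?A \<le> q" by (intro card_hub_arcs circ_arc_in)
  ultimately show ?thesis unfolding in_degree_def by (meson card_mono le_trans)
next
  case (hub t i j)
  let ?A = "(\<lambda>c. (line_point t i c, v)) ` {..<q}"
  have "in_arcs (grid q) v \<subseteq> ?A"
    using hub by (auto simp: in_arcs_def grid_arcs_def)
  moreover have "card ?A \<le> q" by (rule card_line_arcs)
  ultimately show ?thesis unfolding in_degree_def by (meson card_mono finite_imageI finite_lessThan le_trans)
qed

section \<open>Distinct labels and the lower bound\<close>

text \<open>The circulant order fixes which line comes first, so the path through the hub may run
  either way. The lemma serves both the distance-two condition and the connectivity of the
  underlying graph.\<close>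

lemma common_hub:
  fixes t :: bool
  assumes "i < q" "i' < q" "i \<noteq> i'" "c < q" "c' < q"
  shows "\<exists>x y. circ_arc q x y \<and>
    ((line_point t i c, hub t x y) \<in> grid_arcs q \<and> (hub t x y, line_point t i' c') \<in> grid_arcs q \<or>
     (line_point t i' c', hub t x y) \<in> grid_arcs q \<and> (hub t x y, line_point t i c) \<in> grid_arcs q)"
  using circ_arc_total[OF assms(1-3)] assms unfolding grid_arcs_def by blast

lemma points_eq_image: "{point a b | a b. a < q \<and> b < q} = (\<lambda>(a, b). point a b) ` ({..<q} \<times> {..<q})"
  by auto

lemma card_points: "card {point a b | a b. a < q \<and> b < q} = q\<^sup>2"
  unfolding points_eq_image by (subst card_image) (auto simp: inj_on_def power2_eq_square)

text \<open>An optimal labeling is injective on the \<open>q\<^sup>2\<close> points, and its labels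
  lie in a set of size \<open>lambda21 (grid q) + 1\<close>.\<close>

lemma lambda21_grid: "q\<^sup>2 \<le> lambda21 (grid q) + 1"
proof -
  let ?P = "{point a b | a b. a < q \<and> b < q}"
  interpret oriented_graph "grid q" by (rule oriented_graph_grid)
  obtain f where f: "L21_labeling (grid q) (lambda21 (grid q)) f"
    using L21_labeling_lambda21 by blast
  have diff: "f (line_point t i c) \<noteq> f (line_point t i' c')"
    if lt: "i < q" "i' < q" "i \<noteq> i'" "c < q" "c' < q" for t i i' c c'
  proof -
    obtain x y where xy: "circ_arc q x y"
      "(line_point t i c, hub t x y) \<in> grid_arcs q \<and> (hub t x y, line_point t i' c') \<in> grid_arcs q \<or>
       (line_point t i' c', hub t x y) \<in> grid_arcs q \<and> (hub t x y, line_point t i c) \<in> grid_arcs q"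
      using common_hub[OF lt, of t] by blast
    have "1 \<le> \<bar>int (f u) - int (f v)\<bar>"
      if "u \<in> grid_verts q" "v \<in> grid_verts q" "w \<in> grid_verts q" "u \<noteq> v"
        "(u, w) \<in> grid_arcs q \<and> (w, v) \<in> grid_arcs q \<or> (v, w) \<in> grid_arcs q \<and> (w, u) \<in> grid_arcs q"
      for u v w
      using f that unfolding L21_labeling_def grid_simps by blast
    from this[OF _ _ _ _ xy(2)]
    have "1 \<le> \<bar>int (f (line_point t i c)) - int (f (line_point t i' c'))\<bar>"
      using lt xy(1) by (simp add: line_point_in_grid_verts hub_in_grid_verts)
    then show ?thesis by linarith
  qed
  have "inj_on f ?P"
  proof (rule inj_onI)
    fix u v assume "u \<in> ?P" "v \<in> ?P" "f u = f v"
    then obtain a b c d where *: "u = point a b" "v = point c d"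
      "a < q" "b < q" "c < q" "d < q" "f (point a b) = f (point c d)" by blast
    \<comment> \<open>Equal labels exclude different rows; then the same argument with the
      coordinates exchanged excludes different columns.\<close>
    have "a = c" using diff[of a c b d True] * by (auto simp: line_point_def)
    moreover have "b = d" using diff[of b d a c False] * by (auto simp: line_point_def)
    ultimately show "u = v" using * by simp
  qed
  then have "q\<^sup>2 = card (f ` ?P)" by (simp only: card_image card_points)
  also have "\<dots> \<le> card {0..lambda21 (grid q)}"
    using f by (intro card_mono) (auto simp: L21_labeling_def image_subset_iff point_in_grid_verts)
  finally show ?thesis by simp
qed

section \<open>2-connectivity of the underlying graph\<close>

text \<open>\<open>connected\<close> symmetrizes the induced subgraph once more. Edges of
  \<open>U\<close> with both ends in \<open>X\<close> survive restriction and symmetrization, so a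
  walk confined to \<open>X\<close> carries over.\<close>

lemma connected_induced_underlying:
  fixes G :: "('a, 'a \<times> 'a) pre_digraph"
  defines "U \<equiv> parcs (mk_symmetric G)"
  assumes "X \<noteq> {}"
    and reach: "\<And>u v. u \<in> X \<Longrightarrow> v \<in> X \<Longrightarrow> (u, v) \<in> rtrancl_on X U"
  shows "Digraph_Component.connected (with_proj (mk_symmetric G) \<restriction> X)"
proof -
  let ?H = "with_proj (mk_symmetric G) \<restriction> X"
  have "(u, v) \<in> rtrancl_on X (parcs (mk_symmetric ?H))" if "(u, v) \<in> rtrancl_on X U" for u v
    using that
  proof induct
    case (step y z)
    then have "(y, z) \<in> parcs (mk_symmetric ?H)"
      by (auto simp: U_def induce_subgraph_def parcs_mk_symmetric)
    with step show ?case by (auto intro: converse_rtrancl_on_into_rtrancl_on)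
  qed auto
  with assms show ?thesis
    unfolding Digraph_Component.connected_def strongly_connected_def reachable_def by auto
qed

lemma two_connected_grid:
  assumes q: "q \<ge> 2"
  shows "k_connected 2 (with_proj (mk_symmetric (grid q)))"
proof -
  let ?U = "parcs (mk_symmetric (grid q))"
  have U: "?U = grid_arcs q \<union> (grid_arcs q)\<inverse>"
    by (auto simp: parcs_mk_symmetric)
  have "2 < q\<^sup>2" using power_mono[OF q, of 2] by simp
  also have "q\<^sup>2 \<le> card (grid_verts q)"
    unfolding card_points[symmetric]
    by (rule card_mono[OF finite_grid_verts]) (auto simp: point_in_grid_verts)
  finally have size: "2 < card (grid_verts q)" .
  have conn: "Digraph_Component.connected (with_proj (mk_symmetric (grid q)) \<restriction> (grid_verts q - S))"
    if "finite S" "card S < 2" for S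
  proof -
    \<comment> \<open>At most one vertex is deleted; covering \<open>S\<close> by a singleton treats
      the empty deletion at the same time.\<close>
    obtain x where x: "S \<subseteq> {x}"
    proof (cases "S = {}")
      case False
      then have "card S = 1" using \<open>finite S\<close> \<open>card S < 2\<close> card_gt_0_iff[of S] by linarith
      then show ?thesis using that by (auto simp: card_1_singleton_iff)
    qed blast
    define X where "X = grid_verts q - S"
    let ?R = "rtrancl_on X ?U"
    have R_sym: "(v, u) \<in> ?R" if "(u, v) \<in> ?R" for u v
      using rtrancl_on_sym[of ?U X] that U by (auto simp: sym_def)
    note R_trans = rtrancl_on_trans[of _ _ X ?U]
    have adj: "(u, v) \<in> ?R" if "(u, v) \<in> grid_arcs q \<or> (v, u) \<in> grid_arcs q" "u \<in> X" "v \<in> X" for u v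
      using that unfolding U by (auto intro: rtrancl_on_into_rtrancl_on)
    \<comment> \<open>Each line has at least the two points at positions 0 and 1, and only one of
      them can be deleted.\<close>
    have survivor: "\<exists>c < q. line_point t i c \<in> X" if "i < q" for t i
    proof -
      have "line_point t i 0 \<noteq> line_point t i 1" by simp
      then have "line_point t i 0 \<notin> S \<or> line_point t i 1 \<notin> S" using x by blast
      moreover have "0 < q" "1 < q" using q by simp_all
      ultimately show ?thesis
        using \<open>i < q\<close> unfolding X_def Diff_iff line_point_in_grid_verts by blast
    qed
    \<comment> \<open>The single deleted vertex spares the hubs of at least one direction.\<close>
    obtain t where t: "\<And>i j. hub t i j \<notin> S"
    proof (cases "\<exists>i j. x = hub True i j")
      case True
      then have "hub False i j \<notin> S" for i j using x by auto
      then show ?thesis by (rule that)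
    next
      case False
      then have "hub True i j \<notin> S" for i j using x by auto
      then show ?thesis by (rule that)
    qed
    have diff_line: "(line_point t i c, line_point t i' c') \<in> ?R"
      if "i \<noteq> i'" "line_point t i c \<in> X" "line_point t i' c' \<in> X" for i c i' c'
    proof -
      have lt: "i < q" "i' < q" "i \<noteq> i'" "c < q" "c' < q"
        using that by (auto simp: X_def line_point_in_grid_verts)
      obtain x y where xy: "circ_arc q x y"
        "(line_point t i c, hub t x y) \<in> grid_arcs q \<and> (hub t x y, line_point t i' c') \<in> grid_arcs q \<or>
         (line_point t i' c', hub t x y) \<in> grid_arcs q \<and> (hub t x y, line_point t i c) \<in> grid_arcs q"
        using common_hub[OF lt, of t] by blast
      have "hub t x y \<in> X" using t xy by (simp add: X_def hub_in_grid_verts)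
      then have "(line_point t i c, hub t x y) \<in> ?R" "(hub t x y, line_point t i' c') \<in> ?R"
        using xy(2) that adj by blast+
      then show ?thesis by (rule R_trans)
    qed
    have points: "(line_point t i c, line_point t i' c') \<in> ?R"
      if "line_point t i c \<in> X" "line_point t i' c' \<in> X" for i c i' c'
    proof (cases "i = i'")
      \<comment> \<open>Two points on the same line are joined by a detour through a surviving point
        of another line \<open>j\<close>, which exists because \<open>q\<close> is at least
        2.\<close>
      case True
      obtain j where j: "j < q" "j \<noteq> i"
      proof
        show "(if i = 0 then 1 else 0) < q" "(if i = 0 then 1 else 0) \<noteq> i" using q by auto
      qed
      obtain d where "line_point t j d \<in> X" using survivor[OF j(1)] by blast
      with diff_line[of i j c d] diff_line[of j i' d c'] that j True show ?thesis
        by (auto intro: R_trans)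
    qed (use diff_line that in blast)
    have to_point: "\<exists>i c. line_point t i c \<in> X \<and> (u, line_point t i c) \<in> ?R" if "u \<in> X" for u
    proof -
      have "u \<in> grid_verts q" using that X_def by simp
      then show ?thesis
      proof (cases rule: grid_verts_cases)
        case (point a b)
        obtain i c where "line_point True a b = line_point t i c"
          by (rule line_point_change_direction)
        then have "u = line_point t i c" using point by (simp add: line_point_def)
        with that show ?thesis by blast
      next
        case (hub s i j)
        \<comment> \<open>A hub of either direction is adjacent to a surviving point of its source
          line, and that point also lies on a line of direction \<open>t\<close>.\<close>
        obtain c where c: "c < q" "line_point s i c \<in> X"
          using survivor hub circ_arc_lt by blast
        have "(line_point s i c, u) \<in> grid_arcs q"
          using hub c by (auto simp: grid_arcs_def)
        then have "(u, line_point s i c) \<in> ?R" using c that adj by blast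
        moreover obtain i' c' where "line_point s i c = line_point t i' c'"
          by (rule line_point_change_direction)
        ultimately show ?thesis using c(2) by metis
      qed
    qed
    have "X \<noteq> {}" using survivor[of 0] q by auto
    moreover have "(u, v) \<in> ?R" if "u \<in> X" "v \<in> X" for u v
      using to_point[OF that(1)] to_point[OF that(2)] points R_sym R_trans by meson
    ultimately show ?thesis
      unfolding X_def[symmetric] by (rule connected_induced_underlying)
  qed
  show ?thesis
    unfolding k_connected_def using size conn by auto
qed

theorem theorem2:
  shows "\<exists>C::real. \<forall>k::nat. k > 0 \<longrightarrow>
    (\<exists>G :: (nat, nat \<times> nat) pre_digraph.
       oriented_graph G \<and>
       k_connected 2 (with_proj (mk_symmetric G)) \<and>
       (\<forall>v \<in> verts G. real (in_degree G v) \<le> real k + C \<and> real (out_degree G v) \<le> real k + C) \<and>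
       real (lambda21 G) \<ge> (real k)\<^sup>2 - C * real k)"
proof (intro exI[of _ 2] allI impI)
  fix k :: nat
  \<comment> \<open>The degree bound \<open>q = k + 2\<close> leads to \<open>C = 2\<close>. The
    label bound has room to spare, as \<open>(k + 2)\<^sup>2 - 1\<close> equals
    \<open>k\<^sup>2 + 4 * k + 3\<close>.\<close>
  let ?G = "grid (k + 2)"
  have "real (in_degree ?G v) \<le> real k + 2 \<and> real (out_degree ?G v) \<le> real k + 2"
    if "v \<in> verts ?G" for v
    using in_degree_grid[of v "k + 2"] out_degree_grid[of v "k + 2"] that by simp
  moreover have "real (lambda21 ?G) \<ge> (real k)\<^sup>2 - 2 * real k"
  proof -
    have "real ((k + 2)\<^sup>2) \<le> real (lambda21 ?G + 1)"
      using lambda21_grid[of "k + 2"] by (simp only: of_nat_le_iff)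
    then show ?thesis by (simp add: power2_eq_square algebra_simps)
  qed
  ultimately show "\<exists>G :: (nat, nat \<times> nat) pre_digraph. oriented_graph G \<and>
       k_connected 2 (with_proj (mk_symmetric G)) \<and>
       (\<forall>v \<in> verts G. real (in_degree G v) \<le> real k + 2 \<and> real (out_degree G v) \<le> real k + 2) \<and>
       real (lambda21 G) \<ge> (real k)\<^sup>2 - 2 * real k"
    by (intro exI[of _ ?G] conjI ballI oriented_graph_grid two_connected_grid) auto
qed

end
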